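(* There exist absolute constants $c_*>0$, $K>0$ and $p_0$ such that for every prime $p\geqslant p_0$, the number $T(p)$ of ordered triples $(A,B,C)$ of subsets of $\mathbb{F}_p$ such that $x+y\neq z$ for all $x\in A$, $y\in B$, $z\in C$ satisfies $$\bigl|T(p)-3\cdot 4^p-3p\cdot 3^p\bigr|\leqslant K(3-c_* )^p .$$
   Context: $\mathbb{F}_p$ is the field with $p$ elements, viewed as an additive group. The subsets $A,B,C$ may be empty. *)

theory Defs
  imports Complex_Main "HOL-Computational_Algebra.Primes"
begin

definition sum_free_triple :: "nat \<Rightarrow> nat set \<Rightarrow> nat set \<Rightarrow> nat set \<Rightarrow> bool" where
  "sum_free_triple p A B C \<longleftrightarrow>
     (\<forall>x\<in>A. \<forall>y\<in>B. \<forall>z\<in>C. (x + y) mod p \<noteq> z)"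

definition T :: "nat \<Rightarrow> nat" where
  "T p = card {(A, B, C). A \<subseteq> {0..<p} \<and> B \<subseteq> {0..<p} \<and> C \<subseteq> {0..<p}
                 \<and> sum_free_triple p A B C}"

end

theory Submission
  imports Defs "HOL-Analysis.Convex" "HOL-Number_Theory.Cong"
begin

text \<open>
  Fixing one of the three sets at a nonempty value leaves a pair of sets avoiding a family of
  bijections (translations or reflections). The triples in which one set is empty or a singleton
  give the main term exactly, up to pairwise overlaps of size $O(p^2 2^p)$.

  If the fixed set has two elements, the conflicts between the other two sets form a cycle of
  length $2p$, as \<open>p\<close> is prime; cutting the cycle into paths with four vertices, each having
  $8$ independent sets, leaves at most $O(8^{p/2})$ pairs. This settles all triples with a set
  of size at least two but at most a small fraction of \<open>p\<close>.

  If all three sets have at least a large constant number \<open>k\<close> of elements, then each pair is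
  an independent set in a \<open>k\<close>-regular bipartite graph on \<open>p + p\<close> vertices. By Sapozhenko's
  greedy container argument there are at most $(2 + o(1))^p$ of these as \<open>k\<close> grows, and
  the Loomis--Whitney inequality bounds the number of triples by $(2^{3/2} + o(1))^p$.
  Since $2^{3/2} < 3$, this is sufficient.
\<close>

section \<open>Pairs of sets avoiding a family of bijections\<close>

lemma card_small_subsets_le:
  fixes U :: "'a set"
  assumes "finite U"
  shows "real (card {X. X \<subseteq> U \<and> 10000 * card X \<le> card U}) \<le> (1001/1000) ^ (2 * card U)"
proof -
  \<comment> \<open>Give each set \<open>X\<close> the weight \<open>1000\<close> to the power \<open>- card X\<close>; the total weight is \<open>1.001 ^ n\<close>.\<close>
  define n where "n = card U"
  define W where "W = {X. X \<subseteq> U \<and> 10000 * card X \<le> n}"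
  have "finite W" unfolding W_def using assms by auto
  \<comment> \<open>Bernoulli gives 1.001^1000 >= 2, hence 1.001^10000 >= 1024. This links the
    weight 1/1000 to the threshold 10000: 1000^(card X) is at most 1.001^n.\<close>
  have big: "1000 \<le> ((1001/1000)::real) ^ 10000"
  proof -
    have "1 + real 1000 * (1/1000) \<le> (1 + 1/1000) ^ 1000"
      by (rule Bernoulli_inequality) simp
    then have "2 \<le> ((1001/1000)::real) ^ 1000" by simp
    then have "(2::real) ^ 10 \<le> ((1001/1000) ^ 1000) ^ 10" by (rule power_mono) simp
    then show ?thesis by (simp flip: power_mult)
  qed
  have wt: "1 \<le> (1001/1000) ^ n * (1/1000 :: real) ^ card X" if "X \<in> W" for X
  proof -
    have "(1000::real) ^ card X \<le> ((1001/1000) ^ 10000) ^ card X"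
      using big by (rule power_mono) simp
    also have "\<dots> = (1001/1000) ^ (10000 * card X)" by (simp only: power_mult)
    also have "\<dots> \<le> (1001/1000) ^ n"
      using that by (intro power_increasing) (auto simp: W_def)
    finally show ?thesis by (simp add: power_one_over divide_simps mult.commute)
  qed
  have "real (card W) = (\<Sum>X\<in>W. 1)" by simp
  also have "\<dots> \<le> (\<Sum>X\<in>W. (1001/1000) ^ n * (1/1000) ^ card X)" by (intro sum_mono wt)
  also have "\<dots> \<le> (\<Sum>X\<in>Pow U. (1001/1000) ^ n * (1/1000) ^ card X)"
    using assms by (intro sum_mono2) (auto simp: W_def)
  also have "\<dots> = (1001/1000) ^ n * (\<Sum>X\<in>Pow U. (\<Prod>x\<in>X. 1/1000) * (\<Prod>x\<in>U - X. 1))"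
    by (simp add: sum_distrib_left)
  also have "\<dots> = (1001/1000) ^ n * (\<Prod>x\<in>U. 1/1000 + 1)"
    using prod_add[OF assms, of "\<lambda>_. 1/1000::real" "\<lambda>_. 1"] by simp
  also have "\<dots> = (1001/1000) ^ (2 * n)"
    by (simp add: n_def power_add mult_2)
  finally show ?thesis by (simp add: W_def n_def)
qed

section \<open>Independent sets for at most two bijections\<close>

text \<open>These are the independent sets of the bipartite graph on two copies of \<open>U\<close>
  that joins \<open>x\<close> to \<open>F i x\<close> for each \<open>i\<close> in \<open>S\<close>.
  Later \<open>S\<close> is the fixed member of a triple and \<open>F\<close> consists of
  translations or reflections.\<close>

definition avoid :: "'a set \<Rightarrow> ('i \<Rightarrow> 'a \<Rightarrow> 'a) \<Rightarrow> 'i set \<Rightarrow> ('a set \<times> 'a set) set" where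
  "avoid U F S = {(P, Q). P \<subseteq> U \<and> Q \<subseteq> U \<and> (\<forall>i\<in>S. \<forall>x\<in>P. F i x \<notin> Q)}"

lemma avoid_antimono: "S \<subseteq> S' \<Longrightarrow> avoid U F S' \<subseteq> avoid U F S"
  by (auto simp: avoid_def)

lemma finite_avoid: "finite U \<Longrightarrow> finite (avoid U F S)"
  by (rule finite_subset[of _ "Pow U \<times> Pow U"]) (auto simp: avoid_def)

lemma card_avoid_empty: "finite U \<Longrightarrow> card (avoid U F {}) = 4 ^ card U"
proof -
  assume "finite U"
  moreover have "avoid U F {} = Pow U \<times> Pow U" by (auto simp: avoid_def)
  ultimately show ?thesis
    by (simp add: card_cartesian_product card_Pow flip: power_mult_distrib)
qed

text \<open>A single bijection gives a perfect matching, with three choices on each edge. In the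
  proof, \<open>P\<close> leaves 2^(n - card P) choices for \<open>Q\<close>, and the sum over
  \<open>P\<close> is the expansion of (1 + 2)^n.\<close>

lemma card_avoid_singleton:
  assumes "finite U" "bij_betw (F i) U U"
  shows "card (avoid U F {i}) = 3 ^ card U"
proof -
  have "avoid U F {i} = (SIGMA P:Pow U. Pow (U - F i ` P))"
    by (auto simp: avoid_def)
  then have "card (avoid U F {i}) = (\<Sum>P\<in>Pow U. card (Pow (U - F i ` P)))"
    using assms by simp
  also have "\<dots> = (\<Sum>P\<in>Pow U. (\<Prod>x\<in>P. 1) * (\<Prod>x\<in>U - P. 2))"
  proof (rule sum.cong)
    fix P assume "P \<in> Pow U"
    then have "P \<subseteq> U" by simp
    then have "inj_on (F i) P" "F i ` P \<subseteq> U"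
      using assms(2) by (auto simp: bij_betw_def inj_on_subset)
    then have "card (U - F i ` P) = card (U - P)"
      using \<open>P \<subseteq> U\<close> assms(1) by (simp add: card_Diff_subset finite_subset card_image)
    then show "card (Pow (U - F i ` P)) = (\<Prod>x\<in>P. 1) * (\<Prod>x\<in>U - P. 2)"
      using assms(1) by (simp add: card_Pow)
  qed simp
  also have "\<dots> = (\<Prod>x\<in>U. 1 + 2)"
    by (rule prod_add[OF assms(1), symmetric])
  also have "\<dots> = 3 ^ card U" by (simp add: numeral_3_eq_3)
  finally show ?thesis .
qed

text \<open>The conflicts form the path Q0 - P0 - Q1 - P1 - ... on 2n vertices. Cutting off its last
  four vertices costs a factor 8 <= 2.85^2, so the induction goes in steps of two. The factor 3
  accommodates the base case n = 1.\<close>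

lemma card_path_avoid_le:
  "real (card (avoid {..<n} (\<lambda>i j. i + j) {0, Suc 0})) \<le> 3 * (57/20) ^ n"
proof (induction n rule: induct_nat_012)
  case 0
  have "avoid {..<0} (\<lambda>i j. i + j) {0, Suc 0} = {({}, {})}" by (auto simp: avoid_def)
  then show ?case by simp
next
  case 1
  have "avoid {..<1} (\<lambda>i j. i + j) {0, Suc 0} \<subseteq> {({}, {}), ({}, {0}), ({0}, {})}"
    by (auto simp: avoid_def lessThan_Suc subset_singleton_iff)
  then have "card (avoid {..<1} (\<lambda>i j. i + j) {0, Suc 0}) \<le> card {({}, {}), ({}, {0::nat}), ({0::nat}, {})}"
    by (intro card_mono) auto
  then have "card (avoid {..<1} (\<lambda>i j. i + j) {0, Suc 0}) \<le> 3" by simp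
  then show ?case by (simp del: lessThan_Suc)
next
  case (ge2 n)
  let ?A = "\<lambda>n. avoid {..<n} (\<lambda>i j. i + j) {0, Suc 0}"
  \<comment> \<open>Traces on the last four vertices, in the order n in P, n in Q, n+1 in P, n+1 in
    Q. The three forbidden pairs are the edges of the path b - a - d - c.\<close>
  define E where "E = {(a, b, c, d). \<not> (a \<and> b) \<and> \<not> (a \<and> d) \<and> \<not> (c \<and> d)}"
  have "E = {(False,False,False,False),(True,False,False,False),(False,True,False,False),
    (False,False,True,False),(False,False,False,True),(True,False,True,False),
    (False,True,False,True),(False,True,True,False)}" (is "_ = ?E'")
  proof (rule set_eqI)
    fix q :: "bool \<times> bool \<times> bool \<times> bool"
    obtain a b c d where q: "q = (a, b, c, d)" by (cases q) auto
    show "q \<in> E \<longleftrightarrow> q \<in> ?E'"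
      unfolding q E_def by (cases a; cases b; cases c; cases d) simp_all
  qed
  then have E: "finite E" "card E = 8" by simp_all
  let ?h = "\<lambda>(P, Q). ((P \<inter> {..<n}, Q \<inter> {..<n}), (n \<in> P, n \<in> Q, Suc n \<in> P, Suc n \<in> Q))"
  have eqI: "X = X'" if "X \<subseteq> {..<Suc (Suc n)}" "X' \<subseteq> {..<Suc (Suc n)}" "X \<inter> {..<n} = X' \<inter> {..<n}"
    "(n \<in> X) = (n \<in> X')" "(Suc n \<in> X) = (Suc n \<in> X')" for X X'
  proof (rule set_eqI)
    fix t
    consider "t < n" | "t = n" | "t = Suc n" | "t \<notin> {..<Suc (Suc n)}" by force
    then show "(t \<in> X) = (t \<in> X')" using that by cases auto
  qed
  have "inj_on ?h (?A (Suc (Suc n)))"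
  proof (rule inj_onI, clarify)
    fix P Q P' Q'
    assume a: "(P, Q) \<in> ?A (Suc (Suc n))" "(P', Q') \<in> ?A (Suc (Suc n))"
      and e: "P \<inter> {..<n} = P' \<inter> {..<n}" "Q \<inter> {..<n} = Q' \<inter> {..<n}"
        "(n \<in> P) = (n \<in> P')" "(n \<in> Q) = (n \<in> Q')"
        "(Suc n \<in> P) = (Suc n \<in> P')" "(Suc n \<in> Q) = (Suc n \<in> Q')"
    have s: "P \<subseteq> {..<Suc (Suc n)}" "P' \<subseteq> {..<Suc (Suc n)}" "Q \<subseteq> {..<Suc (Suc n)}" "Q' \<subseteq> {..<Suc (Suc n)}"
      using a by (auto simp: avoid_def)
    show "P = P' \<and> Q = Q'"
      using eqI[OF s(1,2) e(1,3,5)] eqI[OF s(3,4) e(2,4,6)] ..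
  qed
  moreover have "?h ` ?A (Suc (Suc n)) \<subseteq> ?A n \<times> E"
  proof (rule image_subsetI)
    fix q assume "q \<in> ?A (Suc (Suc n))"
    then obtain P Q where q: "q = (P, Q)" "(P, Q) \<in> ?A (Suc (Suc n))" by (cases q) auto
    then have "\<forall>x\<in>P. x \<notin> Q \<and> Suc x \<notin> Q" by (auto simp: avoid_def)
    then show "?h q \<in> ?A n \<times> E"
      using q(1) by (auto simp: avoid_def E_def)
  qed
  ultimately have "card (?A (Suc (Suc n))) \<le> card (?A n \<times> E)"
    by (intro card_inj_on_le[of ?h]) (auto simp: finite_avoid E)
  also have "\<dots> = 8 * card (?A n)" by (simp add: card_cartesian_product E)
  finally have "real (card (?A (Suc (Suc n)))) \<le> 8 * real (card (?A n))" by simp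
  also have "\<dots> \<le> (57/20)^2 * (3 * (57/20) ^ n)"
    using ge2.IH(1) by (intro mult_mono) (auto simp: power2_eq_square)
  finally show ?case by (simp add: power2_eq_square)
qed

text \<open>Label the left copy of \<open>U\<close> along \<open>e\<close> and the right copy along
  \<open>F i\<close> after \<open>e\<close>. By \<open>step\<close>, index \<open>t\<close> on the
  left then conflicts with \<open>t\<close> and \<open>t + 1\<close> on the right. The edge that
  would close the cycle at \<open>t = n - 1\<close> is dropped, which can only increase the
  count.\<close>

lemma card_avoid_pair_le:
  fixes U :: "'a set"
  assumes e: "bij_betw e {..<n} U" and f: "bij_betw (F i) U U"
    and step: "\<And>t. Suc t < n \<Longrightarrow> F j (e t) = F i (e (Suc t))"
  shows "real (card (avoid U F {i, j})) \<le> 3 * (57/20) ^ n"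
proof -
  define h where "h = (\<lambda>(P, Q). ({t\<in>{..<n}. e t \<in> P}, {t\<in>{..<n}. F i (e t) \<in> Q}))"
  have U1: "U = e ` {..<n}" and U2: "U = (\<lambda>t. F i (e t)) ` {..<n}"
    using e f by (auto simp: bij_betw_def image_image)
  have "inj_on h (avoid U F {i, j})"
  proof (rule inj_onI, clarify)
    fix P Q P' Q'
    assume a: "(P, Q) \<in> avoid U F {i, j}" "(P', Q') \<in> avoid U F {i, j}" "h (P, Q) = h (P', Q')"
    then have sub: "P \<subseteq> U" "P' \<subseteq> U" "Q \<subseteq> U" "Q' \<subseteq> U" by (auto simp: avoid_def)
    have 1: "P = e ` {t\<in>{..<n}. e t \<in> P}" if "P \<subseteq> U" for P
      using that U1 by auto
    have 2: "Q = (\<lambda>t. F i (e t)) ` {t\<in>{..<n}. F i (e t) \<in> Q}" if "Q \<subseteq> U" for Q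
      using that U2 by auto
    show "P = P' \<and> Q = Q'"
      using 1[OF sub(1)] 1[OF sub(2)] 2[OF sub(3)] 2[OF sub(4)] a(3) unfolding h_def by simp
  qed
  moreover have "h ` avoid U F {i, j} \<subseteq> avoid {..<n} (\<lambda>i j. i + j) {0, Suc 0}"
    using step by (fastforce simp: avoid_def h_def)
  ultimately have "card (avoid U F {i, j}) \<le> card (avoid {..<n} (\<lambda>i j. i + j) {0, Suc 0})"
    by (intro card_inj_on_le[of h]) (auto simp: finite_avoid)
  then show ?thesis using card_path_avoid_le[of n] by linarith
qed

section \<open>Greedy containers\<close>

text \<open>
  A set \<open>T\<close> of maximal size among those with at least \<open>m\<close> neighbours per element: adding
  a point to \<open>T\<close> reaches fewer than \<open>m\<close> new neighbours.
\<close>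

lemma greedy_cover:
  assumes "finite U" "finite S" "0 < m" "B \<subseteq> U"
    and F: "\<And>i x. i \<in> S \<Longrightarrow> x \<in> U \<Longrightarrow> F i x \<in> U"
    and inj: "\<And>x. x \<in> U \<Longrightarrow> inj_on (\<lambda>i. F i x) S"
  obtains T where "T \<subseteq> B" "m * card T \<le> card U"
    "\<And>x. x \<in> B \<Longrightarrow> card {i\<in>S. F i x \<notin> (\<lambda>(i, x). F i x) ` (S \<times> T)} < m"
proof -
  define N where "N T = (\<lambda>(i, x). F i x) ` (S \<times> T)" for T
  define \<T> where "\<T> = {T. T \<subseteq> B \<and> m * card T \<le> card (N T)}"
  have "finite B" using assms by (auto intro: finite_subset)
  then have "finite \<T>" by (auto simp: \<T>_def)
  moreover have "{} \<in> \<T>" by (auto simp: \<T>_def)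
  ultimately have "Max (card ` \<T>) \<in> card ` \<T>" by (intro Max_in) auto
  then obtain T where T: "T \<in> \<T>" "card T = Max (card ` \<T>)" by auto
  then have max: "card T' \<le> card T" if "T' \<in> \<T>" for T'
    using that \<open>finite \<T>\<close> by simp
  have TB: "T \<subseteq> B" "m * card T \<le> card (N T)" using T by (auto simp: \<T>_def)
  have fT: "finite T" using TB \<open>finite B\<close> finite_subset by blast
  have fN: "finite (N T')" if "finite T'" for T' using that assms(2) by (auto simp: N_def)
  have "N T \<subseteq> U" using TB assms(4) F by (auto simp: N_def)
  then have "m * card T \<le> card U" using TB card_mono[OF assms(1)] le_trans by blast
  moreover have "card {i\<in>S. F i x \<notin> N T} < m" if "x \<in> B" for x
  proof (rule ccontr)
    assume "\<not> ?thesis"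
    then have ge: "m \<le> card {i\<in>S. F i x \<notin> N T}" by simp
    have "x \<notin> T"
    proof
      assume "x \<in> T"
      then have "{i\<in>S. F i x \<notin> N T} = {}" by (force simp: N_def)
      with ge assms(3) show False by simp
    qed
    \<comment> \<open>Distinct missed indices give distinct new neighbours of \<open>x\<close>, so
      \<open>insert x T\<close> would again have \<open>m\<close> neighbours per element, against
      maximality.\<close>
    let ?I = "(\<lambda>i. F i x) ` {i\<in>S. F i x \<notin> N T}"
    have "card ?I = card {i\<in>S. F i x \<notin> N T}"
      by (intro card_image inj_on_subset[OF inj]) (use that assms(4) in auto)
    moreover have "card (N T \<union> ?I) = card (N T) + card ?I"
      using fN[OF fT] assms(2) by (intro card_Un_disjoint) auto
    moreover have "card (N T \<union> ?I) \<le> card (N (insert x T))"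
      using fT by (intro card_mono fN) (auto simp: N_def)
    ultimately have "m * card (insert x T) \<le> card (N (insert x T))"
      using TB ge fT \<open>x \<notin> T\<close> by simp
    then have "insert x T \<in> \<T>" using TB that by (auto simp: \<T>_def)
    from max[OF this] show False using fT \<open>x \<notin> T\<close> by simp
  qed
  ultimately show thesis using that TB(1) by (simp add: N_def)
qed

text \<open>Double count the pairs (i, x) with \<open>F i x\<close> in \<open>W\<close>: a covered
  \<open>x\<close> lies in at least 100m of them, while each of the 101m bijections hits
  \<open>W\<close> from exactly \<open>card W\<close> points.\<close>

lemma card_covered_le:
  assumes "finite U" "finite S" "card S = 101 * m" "0 < m" "W \<subseteq> U"
    and bij: "\<And>i. i \<in> S \<Longrightarrow> bij_betw (F i) U U"
  shows "100 * card {x\<in>U. card {i\<in>S. F i x \<notin> W} < m} \<le> 101 * card W"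
proof -
  define D where "D = {x\<in>U. card {i\<in>S. F i x \<notin> W} < m}"
  have D: "finite D" "D \<subseteq> U" using assms(1) by (auto simp: D_def)
  have "100 * m \<le> card {i\<in>S. F i x \<in> W}" if "x \<in> D" for x
  proof -
    have "card S = card {i\<in>S. F i x \<in> W} + card {i\<in>S. F i x \<notin> W}"
      by (subst card_Un_disjoint[symmetric]) (use assms(2) in \<open>auto intro!: arg_cong[of _ _ card]\<close>)
    then show ?thesis using that assms(3) by (simp add: D_def)
  qed
  then have "(\<Sum>x\<in>D. 100 * m) \<le> (\<Sum>x\<in>D. card {i\<in>S. F i x \<in> W})"
    by (rule sum_mono)
  also have "\<dots> \<le> (\<Sum>x\<in>U. card {i\<in>S. F i x \<in> W})"
    using D assms(1) by (intro sum_mono2) auto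
  also have "\<dots> = (\<Sum>i\<in>S. card {x\<in>U. F i x \<in> W})"
    using sum_multicount_gen[of U S "\<lambda>x i. F i x \<in> W" "\<lambda>i. card {x\<in>U. F i x \<in> W}"] assms(1,2)
    by simp
  also have "\<dots> = (\<Sum>i\<in>S. card W)"
  proof (rule sum.cong)
    fix i assume "i \<in> S"
    have "F i ` {x\<in>U. F i x \<in> W} = W"
      using bij[OF \<open>i \<in> S\<close>] assms(5) by (auto simp: bij_betw_def)
    moreover have "inj_on (F i) {x\<in>U. F i x \<in> W}"
      using bij[OF \<open>i \<in> S\<close>] by (auto simp: bij_betw_def intro: inj_on_subset)
    ultimately show "card {x\<in>U. F i x \<in> W} = card W" by (metis card_image)
  qed simp
  finally show ?thesis using assms(3,4) by (simp add: D_def)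
qed

lemma card_avoid_large_le:
  fixes F :: "'i \<Rightarrow> 'a \<Rightarrow> 'a"
  assumes "finite U" "finite S" "card S = 1010000"
    and bij: "\<And>i. i \<in> S \<Longrightarrow> bij_betw (F i) U U"
    and inj: "\<And>x. x \<in> U \<Longrightarrow> inj_on (\<lambda>i. F i x) S"
  shows "real (card (avoid U F S)) \<le> (1001/1000) ^ (2 * card U) * (202/100) ^ card U"
proof -
  \<comment> \<open>With \<open>m = 10000\<close> and \<open>card S = 101 * m\<close>, each pair \<open>(B, C)\<close> lies in a container
    \<open>Pow (D T) \<times> Pow (U - N T)\<close> with \<open>card (D T) + card (U - N T) \<le> 1.01 * n\<close>.\<close>
  define n where "n = card U"
  define \<T> where "\<T> = {T. T \<subseteq> U \<and> 10000 * card T \<le> card U}"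
  define N where "N T = (\<lambda>(i, x). F i x) ` (S \<times> T)" for T
  define D where "D T = {x\<in>U. card {i\<in>S. F i x \<notin> N T} < 10000}" for T
  have "finite \<T>" using assms(1) by (auto simp: \<T>_def)
  have FU: "F i x \<in> U" if "i \<in> S" "x \<in> U" for i x
    using bij that by (auto simp: bij_betw_def)
  have "avoid U F S \<subseteq> (\<Union>T\<in>\<T>. Pow (D T) \<times> Pow (U - N T))"
  proof clarify
    fix B C assume BC: "(B, C) \<in> avoid U F S"
    then have "B \<subseteq> U" "C \<subseteq> U" by (auto simp: avoid_def)
    obtain T where T: "T \<subseteq> B" "10000 * card T \<le> card U"
      "\<And>x. x \<in> B \<Longrightarrow> card {i\<in>S. F i x \<notin> (\<lambda>(i, x). F i x) ` (S \<times> T)} < 10000"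
      by (rule greedy_cover[OF assms(1,2) _ \<open>B \<subseteq> U\<close> FU inj, of 10000]) auto
    \<comment> \<open>\<open>T\<close> is a fingerprint of the pair: \<open>T\<close> inside
      \<open>B\<close> forces \<open>C\<close> off \<open>N T\<close>, and the greedy property puts
      \<open>B\<close> inside \<open>D T\<close>. The container depends on \<open>T\<close> alone,
      and there are few such small sets.\<close>
    have "B \<subseteq> D T" using T \<open>B \<subseteq> U\<close> unfolding D_def N_def by auto
    moreover have "C \<subseteq> U - N T" using BC T by (auto simp: avoid_def N_def)
    moreover have "T \<in> \<T>" using T \<open>B \<subseteq> U\<close> by (auto simp: \<T>_def)
    ultimately show "(B, C) \<in> (\<Union>T\<in>\<T>. Pow (D T) \<times> Pow (U - N T))" by blast
  qed
  then have "card (avoid U F S) \<le> card (\<Union>T\<in>\<T>. Pow (D T) \<times> Pow (U - N T))"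
    using \<open>finite \<T>\<close> assms(1) by (intro card_mono) (auto simp: D_def)
  also have "\<dots> \<le> (\<Sum>T\<in>\<T>. card (Pow (D T) \<times> Pow (U - N T)))"
    using \<open>finite \<T>\<close> by (rule card_UN_le)
  finally have "real (card (avoid U F S)) \<le> (\<Sum>T\<in>\<T>. real (card (Pow (D T) \<times> Pow (U - N T))))"
    by (simp only: of_nat_sum[symmetric] of_nat_le_iff)
  also have "\<dots> \<le> (\<Sum>T\<in>\<T>. (202/100) ^ n)"
  proof (rule sum_mono)
    fix T assume "T \<in> \<T>"
    then have NU: "N T \<subseteq> U" using FU by (auto simp: N_def \<T>_def)
    have "100 * card (D T) \<le> 101 * card (N T)"
      unfolding D_def by (rule card_covered_le[OF assms(1,2) _ _ NU bij]) (use assms(3) in auto)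
    moreover have "card (N T) \<le> n" "card (U - N T) + card (N T) = n"
      using NU assms(1) by (auto simp: n_def card_mono card_Diff_subset finite_subset)
    \<comment> \<open>Removing \<open>N T\<close> from \<open>U\<close> gains exactly
      \<open>card (N T)\<close>, which pays for \<open>D T\<close> up to a hundredth of
      \<open>card (N T)\<close>.\<close>
    ultimately have le: "100 * (card (D T) + card (U - N T)) \<le> 101 * n"
      unfolding add_mult_distrib2 by linarith
    define s where "s = card (D T) + card (U - N T)"
    have "1 + real 100 * (1/100) \<le> (1 + 1/100) ^ 100"
      by (rule Bernoulli_inequality) simp
    then have two: "2 \<le> ((101/100)::real) ^ 100" by simp
    \<comment> \<open>Truncated subtraction also covers s < n. The excess \<open>s - n\<close> is at
      most n/100, and 2 <= 1.01^100 turns it into a factor 1.01^n.\<close>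
    have "(2::real) ^ s \<le> 2 ^ n * 2 ^ (s - n)"
      by (simp flip: power_add)
    also have "\<dots> \<le> 2 ^ n * ((101/100) ^ 100) ^ (s - n)"
      using two by (intro mult_left_mono power_mono) auto
    also have "\<dots> = 2 ^ n * (101/100) ^ (100 * (s - n))" by (simp only: power_mult)
    also have "\<dots> \<le> 2 ^ n * (101/100) ^ n"
      using le by (intro mult_left_mono power_increasing) (auto simp: s_def)
    also have "\<dots> = (202/100) ^ n" by (simp flip: power_mult_distrib)
    finally have "(2::real) ^ s \<le> (202/100) ^ n" .
    moreover have "card (Pow (D T) \<times> Pow (U - N T)) = 2 ^ s"
      using assms(1) by (simp add: card_cartesian_product card_Pow D_def s_def power_add)
    ultimately show "real (card (Pow (D T) \<times> Pow (U - N T))) \<le> (202/100) ^ n" by simp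
  qed
  also have "\<dots> = real (card \<T>) * (202/100) ^ n" by simp
  also have "\<dots> \<le> (1001/1000) ^ (2 * card U) * (202/100) ^ n"
    unfolding \<T>_def by (intro mult_right_mono card_small_subsets_le assms) simp
  finally show ?thesis by (simp add: n_def)
qed

section \<open>The Loomis-Whitney inequality\<close>

lemma Loomis_Whitney:
  assumes "finite X"
    and "finite P1" "\<And>a b c. (a, b, c) \<in> X \<Longrightarrow> (a, b) \<in> P1"
    and "finite P2" "\<And>a b c. (a, b, c) \<in> X \<Longrightarrow> (a, c) \<in> P2"
    and "finite P3" "\<And>a b c. (a, b, c) \<in> X \<Longrightarrow> (b, c) \<in> P3"
  shows "(card X)\<^sup>2 \<le> card P1 * card P2 * card P3"
proof -
  \<comment> \<open>Cauchy--Schwarz over the fibres of the first projection.\<close>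
  define d where "d q = {c. (fst q, snd q, c) \<in> X}" for q
  have fd: "finite (d q)" for q
    by (rule finite_subset[of _ "(\<lambda>(a, b, c). c) ` X"]) (use assms(1) in \<open>force simp: d_def\<close>)+
  have "bij_betw (\<lambda>(a, b, c). ((a, b), c)) X (SIGMA q:P1. d q)"
    by (rule bij_betwI[where g = "\<lambda>((a, b), c). (a, b, c)"]) (use assms(3) in \<open>auto simp: d_def\<close>)
  then have "card X = card (SIGMA q:P1. d q)" by (rule bij_betw_same_card)
  also have "\<dots> = (\<Sum>q\<in>P1. card (d q))" using assms(2) fd by simp
  finally have cX: "card X = (\<Sum>q\<in>P1. card (d q))" .
  have "(\<Sum>q\<in>P1. (card (d q))\<^sup>2) = (\<Sum>q\<in>P1. card (d q \<times> d q))"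
    by (simp add: card_cartesian_product power2_eq_square)
  also have "\<dots> = card (SIGMA q:P1. d q \<times> d q)" using assms(2) fd by simp
  \<comment> \<open>Two points (a, b, c) and (a, b, c') of one fibre are recovered from the
    projections (a, c) and (b, c').\<close>
  also have "\<dots> \<le> card (P2 \<times> P3)"
    by (rule card_inj_on_le[of "\<lambda>((a, b), c, c'). ((a, c), (b, c'))"])
      (use assms in \<open>auto simp: inj_on_def d_def\<close>)
  finally have sq: "(\<Sum>q\<in>P1. (card (d q))\<^sup>2) \<le> card P2 * card P3"
    by (simp add: card_cartesian_product)
  have "(real (card X))\<^sup>2 = (\<Sum>q\<in>P1. real (card (d q)))\<^sup>2" by (simp add: cX)
  also have "\<dots> \<le> real (card P1) * (\<Sum>q\<in>P1. (real (card (d q)))\<^sup>2)"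
    using sum_squared_le_sum_of_squares[of "\<lambda>q. real (card (d q))" P1] assms(2)
    by (simp add: mult.commute)
  also have "\<dots> = real (card P1 * (\<Sum>q\<in>P1. (card (d q))\<^sup>2))" by simp
  also have "\<dots> \<le> real (card P1 * (card P2 * card P3))"
    using sq by (intro of_nat_mono mult_left_mono) auto
  finally show ?thesis by (simp only: of_nat_power[symmetric] of_nat_le_iff mult.assoc)
qed

section \<open>Counts by the size of the fixed set\<close>

text \<open>The table of values \<open>F i x\<close> is a Latin square on \<open>U\<close>. The
  final clause adds the bound for two rows, so that translations and reflections can be counted by
  the same lemmas.\<close>

definition latin_family :: "'a set \<Rightarrow> ('a \<Rightarrow> 'a \<Rightarrow> 'a) \<Rightarrow> bool" where
  "latin_family U F \<longleftrightarrow> finite U \<and> (\<forall>i\<in>U. bij_betw (F i) U U) \<and> (\<forall>x\<in>U. inj_on (\<lambda>i. F i x) U) \<and>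
     (\<forall>i\<in>U. \<forall>j\<in>U. i \<noteq> j \<longrightarrow> real (card (avoid U F {i, j})) \<le> 3 * (57/20) ^ card U)"

lemma subsets_card_le_one:
  assumes "finite U"
  shows "{S. S \<subseteq> U \<and> card S \<le> 1} = insert {} ((\<lambda>i. {i}) ` U)"
proof (rule set_eqI)
  fix S
  show "S \<in> {S. S \<subseteq> U \<and> card S \<le> 1} \<longleftrightarrow> S \<in> insert {} ((\<lambda>i. {i}) ` U)"
    using assms finite_subset[of S U] by (auto simp: le_Suc_eq card_1_singleton_iff)
qed

text \<open>Source of the main term: the empty set contributes 4^n and each of the n singletons 3^n.
  Each of the three positions in a triple supplies one such count.\<close>

lemma card_avoid_le_one:
  assumes "latin_family U F"
  shows "card (SIGMA S:{S. S \<subseteq> U \<and> card S \<le> 1}. avoid U F S) = 4 ^ card U + card U * 3 ^ card U"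
proof -
  have fin: "finite U" and bij: "\<And>i. i \<in> U \<Longrightarrow> bij_betw (F i) U U"
    using assms by (auto simp: latin_family_def)
  have "card (SIGMA S:{S. S \<subseteq> U \<and> card S \<le> 1}. avoid U F S)
      = (\<Sum>S\<in>insert {} ((\<lambda>i. {i}) ` U). card (avoid U F S))"
    using fin unfolding subsets_card_le_one[OF fin] by (simp add: finite_avoid)
  also have "\<dots> = card (avoid U F {}) + (\<Sum>i\<in>U. card (avoid U F {i}))"
    using fin by (subst sum.insert) (auto simp: sum.reindex)
  also have "\<dots> = 4 ^ card U + (\<Sum>i\<in>U. 3 ^ card U)"
    using fin bij by (simp add: card_avoid_empty card_avoid_singleton)
  finally show ?thesis by simp
qed

text \<open>Two elements of \<open>S\<close> already limit the pairs to the path bound, and the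
  bound on \<open>k\<close> keeps the number of possible \<open>S\<close> down to
  1.001^(2n).\<close>

lemma card_avoid_medium_le:
  assumes "latin_family U F" "10000 * k \<le> card U"
  shows "real (card (SIGMA S:{S. S \<subseteq> U \<and> 2 \<le> card S \<and> card S \<le> k}. avoid U F S))
    \<le> (1001/1000) ^ (2 * card U) * (3 * (57/20) ^ card U)"
proof -
  have fin: "finite U" using assms by (auto simp: latin_family_def)
  let ?M = "{S. S \<subseteq> U \<and> 2 \<le> card S \<and> card S \<le> k}"
  have fM: "finite ?M" using fin by auto
  have "real (card (SIGMA S:?M. avoid U F S)) = (\<Sum>S\<in>?M. real (card (avoid U F S)))"
    using fin fM by (simp add: finite_avoid)
  also have "\<dots> \<le> (\<Sum>S\<in>?M. 3 * (57/20) ^ card U)"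
  proof (rule sum_mono)
    fix S assume S: "S \<in> ?M"
    then obtain i j where ij: "i \<in> S" "j \<in> S" "i \<noteq> j"
      by (metis (mono_tags, lifting) card_le_Suc0_iff_eq card.infinite mem_Collect_eq not_less_eq_eq
          numeral_2_eq_2 le_zero_eq nat.distinct(1))
    have "card (avoid U F S) \<le> card (avoid U F {i, j})"
      using ij fin by (intro card_mono finite_avoid avoid_antimono) auto
    moreover have "i \<in> U" "j \<in> U" using ij S by auto
    then have "real (card (avoid U F {i, j})) \<le> 3 * (57/20) ^ card U"
      using assms(1) ij(3) unfolding latin_family_def by blast
    ultimately show "real (card (avoid U F S)) \<le> 3 * (57/20) ^ card U" by linarith
  qed
  also have "\<dots> = real (card ?M) * (3 * (57/20) ^ card U)" by simp
  also have "\<dots> \<le> (1001/1000) ^ (2 * card U) * (3 * (57/20) ^ card U)"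
  proof (rule mult_right_mono)
    have "10000 * card X \<le> card U" if "card X \<le> k" for X :: "'a set"
      using that assms(2) by linarith
    then have "card ?M \<le> card {X. X \<subseteq> U \<and> 10000 * card X \<le> card U}"
      using fin by (intro card_mono) auto
    then show "real (card ?M) \<le> (1001/1000) ^ (2 * card U)"
      using card_small_subsets_le[OF fin] by linarith
  qed simp
  finally show ?thesis .
qed

text \<open>The union forgets \<open>S\<close>, as a projection of the set of triples does. Each
  large \<open>S\<close> may be shrunk to exactly 1010000 = 101 * 10000 elements, the size used for
  containers. Of the exponent \<open>4 * card U\<close>, half pays for the choice of the shrunken
  set and half for the fingerprint.\<close>

lemma card_avoid_many_le:
  assumes "latin_family U F" "10000 * 1010000 \<le> card U"
  shows "real (card (\<Union>S\<in>{S. S \<subseteq> U \<and> 1010000 \<le> card S}. avoid U F S))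
    \<le> (1001/1000) ^ (4 * card U) * (202/100) ^ card U"
proof -
  have fin: "finite U" and bij: "\<And>i. i \<in> U \<Longrightarrow> bij_betw (F i) U U"
    and inj: "\<And>x. x \<in> U \<Longrightarrow> inj_on (\<lambda>i. F i x) U"
    using assms by (auto simp: latin_family_def)
  let ?M = "{S. S \<subseteq> U \<and> card S = 1010000}"
  have fM: "finite ?M" using fin by auto
  have "(\<Union>S\<in>{S. S \<subseteq> U \<and> 1010000 \<le> card S}. avoid U F S) \<subseteq> (\<Union>S\<in>?M. avoid U F S)"
  proof (rule UN_least)
    fix S assume "S \<in> {S. S \<subseteq> U \<and> 1010000 \<le> card S}"
    then have S: "1010000 \<le> card S" "S \<subseteq> U" by simp_all
    obtain S' where "S' \<subseteq> S" "card S' = 1010000"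
      using obtain_subset_with_card_n[OF S(1)] by blast
    then show "avoid U F S \<subseteq> (\<Union>S\<in>?M. avoid U F S)"
      using S(2) avoid_antimono[of S' S U F] by blast
  qed
  then have "card (\<Union>S\<in>{S. S \<subseteq> U \<and> 1010000 \<le> card S}. avoid U F S) \<le> card (\<Union>S\<in>?M. avoid U F S)"
    using fM fin by (intro card_mono) (auto simp: finite_avoid)
  also have "\<dots> \<le> (\<Sum>S\<in>?M. card (avoid U F S))"
    using fM by (rule card_UN_le)
  finally have "real (card (\<Union>S\<in>{S. S \<subseteq> U \<and> 1010000 \<le> card S}. avoid U F S))
      \<le> (\<Sum>S\<in>?M. real (card (avoid U F S)))"
    by (simp only: of_nat_sum[symmetric] of_nat_le_iff)
  also have "\<dots> \<le> (\<Sum>S\<in>?M. (1001/1000) ^ (2 * card U) * (202/100) ^ card U)"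
  proof (rule sum_mono)
    fix S assume S: "S \<in> ?M"
    then have "S \<subseteq> U" "card S = 1010000" by auto
    then show "real (card (avoid U F S)) \<le> (1001/1000) ^ (2 * card U) * (202/100) ^ card U"
      using fin bij inj by (intro card_avoid_large_le) (auto intro: finite_subset inj_on_subset)
  qed
  also have "\<dots> = real (card ?M) * ((1001/1000) ^ (2 * card U) * (202/100) ^ card U)" by simp
  also have "\<dots> \<le> (1001/1000) ^ (2 * card U) * ((1001/1000) ^ (2 * card U) * (202/100) ^ card U)"
  proof (rule mult_right_mono)
    have "10000 * card X \<le> card U" if "card X = 1010000" for X :: "'a set"
      using that assms(2) by linarith
    then have "card ?M \<le> card {X. X \<subseteq> U \<and> 10000 * card X \<le> card U}"
      using fin by (intro card_mono) auto
    then show "real (card ?M) \<le> (1001/1000) ^ (2 * card U)"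
      using card_small_subsets_le[OF fin] by linarith
  qed simp
  also have "\<dots> = (1001/1000) ^ (2 * card U + 2 * card U) * (202/100) ^ card U"
    by (simp only: power_add mult.assoc)
  finally show ?thesis by simp
qed

section \<open>Translations and reflections modulo a prime\<close>

definition shift :: "nat \<Rightarrow> nat \<Rightarrow> nat \<Rightarrow> nat" where
  "shift p s x = (s + x) mod p"

text \<open>This is s - x modulo p; the form \<open>p - x\<close> avoids truncation for residues x <
  p.\<close>

definition reflect :: "nat \<Rightarrow> nat \<Rightarrow> nat \<Rightarrow> nat" where
  "reflect p s x = (s + (p - x)) mod p"

lemma inj_on_shift: "inj_on (shift p s) {0..<p}"
proof (rule inj_onI)
  fix x y assume "x \<in> {0..<p}" "y \<in> {0..<p}" "shift p s x = shift p s y"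
  then have "[s + x = s + y] (mod p)" by (simp add: shift_def cong_def)
  then have "[x = y] (mod p)" by (simp only: cong_add_lcancel_nat)
  then show "x = y"
    using \<open>x \<in> _\<close> \<open>y \<in> _\<close> by (auto intro: cong_less_modulus_unique_nat)
qed

lemma shift_reflect: "z < p \<Longrightarrow> x < p \<Longrightarrow> shift p x (reflect p z x) = z"
  by (simp add: shift_def reflect_def mod_add_right_eq)

lemma reflect_eq_iff:
  assumes "x < p" "y < p" "z < p"
  shows "reflect p z x = y \<longleftrightarrow> shift p x y = z"
proof
  assume "shift p x y = z"
  then have "shift p x y = shift p x (reflect p z x)" using assms shift_reflect by simp
  moreover have "reflect p z x \<in> {0..<p}" using assms by (simp add: reflect_def)
  ultimately show "reflect p z x = y"
    using inj_on_shift[of p x] assms by (metis atLeastLessThan_iff inj_onD le0)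
qed (use assms shift_reflect in auto)

lemma shift_commute: "shift p x y = shift p y x"
  by (simp add: shift_def add.commute)

lemma bij_betw_endo: "finite U \<Longrightarrow> inj_on f U \<Longrightarrow> f ` U \<subseteq> U \<Longrightarrow> bij_betw f U U"
  by (simp add: bij_betw_def endo_inj_surj)

text \<open>Primality enters here: a nonzero \<open>d\<close> is invertible, so steps of length
  \<open>d\<close> visit every residue once. Hence two translations or two reflections yield one
  long cycle instead of several short ones.\<close>

lemma bij_betw_multiples:
  fixes p d :: nat
  assumes "prime p" "0 < d" "d < p"
  shows "bij_betw (\<lambda>t. (t * d) mod p) {..<p} {0..<p}"
proof -
  have "\<not> p dvd d" using assms(2,3) dvd_imp_le[of p d] by linarith
  then have cop: "coprime d p" using assms(1) prime_imp_coprime coprime_commute by blast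
  have "inj_on (\<lambda>t. (t * d) mod p) {..<p}"
  proof (rule inj_onI)
    fix x y assume "x \<in> {..<p}" "y \<in> {..<p}" "(x * d) mod p = (y * d) mod p"
    then have "[x * d = y * d] (mod p)" by (simp add: cong_def)
    then have "[x = y] (mod p)" using cop by (simp only: cong_mult_rcancel_nat)
    then show "x = y"
      using \<open>x \<in> _\<close> \<open>y \<in> _\<close> by (auto intro: cong_less_modulus_unique_nat)
  qed
  moreover have "(\<lambda>t. (t * d) mod p) ` {..<p} \<subseteq> {..<p}" using assms by auto
  ultimately have "bij_betw (\<lambda>t. (t * d) mod p) {..<p} {..<p}" by (intro bij_betw_endo) auto
  then show ?thesis by (simp add: atLeast0LessThan)
qed

lemma bij_betw_shift: "0 < p \<Longrightarrow> bij_betw (shift p s) {0..<p} {0..<p}"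
  by (intro bij_betw_endo inj_on_shift) (auto simp: shift_def)

lemma bij_betw_reflect:
  assumes "s < p"
  shows "bij_betw (reflect p s) {0..<p} {0..<p}"
proof -
  have r: "reflect p s x \<in> {0..<p}" for x using assms by (auto simp: reflect_def)
  have "inj_on (reflect p s) {0..<p}"
  proof (rule inj_onI)
    fix x y assume xy: "x \<in> {0..<p}" "y \<in> {0..<p}" "reflect p s x = reflect p s y"
    then have "shift p x (reflect p s x) = shift p y (reflect p s x)"
      using shift_reflect[of s p x] shift_reflect[of s p y] assms by simp
    then show "x = y"
      using inj_onD[OF inj_on_shift[of p "reflect p s x"]] xy by (simp add: shift_commute)
  qed
  then show ?thesis using r by (intro bij_betw_endo) auto
qed

lemma latin_family_shift:
  assumes "prime p"
  shows "latin_family {0..<p} (shift p)"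
proof -
  have p: "0 < p" using assms prime_gt_0_nat by blast
  \<comment> \<open>Walk in steps of j - i: the relation j + t(j - i) = i + (t + 1)(j - i) makes
    consecutive points share a neighbour.\<close>
  have le: "real (card (avoid {0..<p} (shift p) {i, j})) \<le> 3 * (57/20) ^ p" if "i < j" "j < p" for i j
  proof (rule card_avoid_pair_le)
    show "bij_betw (\<lambda>t. (t * (j - i)) mod p) {..<p} {0..<p}"
      using that assms by (intro bij_betw_multiples) auto
    show "bij_betw (shift p i) {0..<p} {0..<p}" using p by (rule bij_betw_shift)
    fix t
    have "j + t * (j - i) = i + Suc t * (j - i)" using that by simp
    then show "shift p j ((t * (j - i)) mod p) = shift p i ((Suc t * (j - i)) mod p)"
      by (simp only: shift_def mod_add_right_eq)
  qed
  have "real (card (avoid {0..<p} (shift p) {i, j})) \<le> 3 * (57/20) ^ p"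
    if "i < p" "j < p" "i \<noteq> j" for i j
    using le[of i j] le[of j i] that by (cases "i < j") (auto simp: insert_commute)
  moreover have "inj_on (\<lambda>i. shift p i x) {0..<p}" for x
    using inj_on_shift[of p x] by (subst shift_commute)
  ultimately show ?thesis using bij_betw_shift[OF p] by (auto simp: latin_family_def)
qed

lemma latin_family_reflect:
  assumes "prime p"
  shows "latin_family {0..<p} (reflect p)"
proof -
  have p: "0 < p" using assms prime_gt_0_nat by blast
  \<comment> \<open>For reflections the indices swap roles, since i - x = j - (x + (j - i)); hence
    the order \<open>{j, i}\<close>.\<close>
  have le: "real (card (avoid {0..<p} (reflect p) {j, i})) \<le> 3 * (57/20) ^ p" if "i < j" "j < p" for i j
  proof (rule card_avoid_pair_le)
    show "bij_betw (\<lambda>t. (t * (j - i)) mod p) {..<p} {0..<p}"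
      using that assms by (intro bij_betw_multiples) auto
    show "bij_betw (reflect p j) {0..<p} {0..<p}" using that by (intro bij_betw_reflect)
    fix t
    define x where "x = (t * (j - i)) mod p"
    define r where "r = reflect p i x"
    have x: "x < p" using p by (simp add: x_def)
    have rp: "r < p" using p by (simp add: r_def reflect_def)
    have x': "(Suc t * (j - i)) mod p = (x + (j - i)) mod p"
      by (simp add: x_def mod_add_right_eq mod_add_left_eq add.commute)
    have "shift p ((x + (j - i)) mod p) r = ((x + r) mod p + (j - i)) mod p"
      by (simp add: shift_def mod_add_left_eq mod_add_right_eq ac_simps)
    also have "(x + r) mod p = i"
      using shift_reflect[of i p x] x that by (simp add: r_def shift_def)
    also have "(i + (j - i)) mod p = j" using that by simp
    finally have "reflect p j ((x + (j - i)) mod p) = r"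
      using rp that p by (subst reflect_eq_iff) auto
    then show "reflect p i ((t * (j - i)) mod p) = reflect p j ((Suc t * (j - i)) mod p)"
      unfolding x' by (simp add: x_def r_def)
  qed
  have "real (card (avoid {0..<p} (reflect p) {i, j})) \<le> 3 * (57/20) ^ p"
    if "i < p" "j < p" "i \<noteq> j" for i j
    using le[of i j] le[of j i] that by (cases "i < j") (auto simp: insert_commute)
  moreover have "inj_on (\<lambda>i. reflect p i x) {0..<p}" if "x < p" for x
  proof (rule inj_onI)
    fix i j assume "i \<in> {0..<p}" "j \<in> {0..<p}" and eq: "reflect p i x = reflect p j x"
    then have "i < p" "j < p" by simp_all
    then show "i = j" using eq shift_reflect that by metis
  qed
  ultimately show ?thesis using bij_betw_reflect by (simp add: latin_family_def)
qed

section \<open>Counting sum-free triples\<close>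

definition sum_free_triples :: "nat \<Rightarrow> (nat set \<times> nat set \<times> nat set) set" where
  "sum_free_triples p = {(A, B, C). A \<subseteq> {0..<p} \<and> B \<subseteq> {0..<p} \<and> C \<subseteq> {0..<p} \<and> sum_free_triple p A B C}"

lemma finite_sum_free_triples: "finite (sum_free_triples p)"
  by (rule finite_subset[of _ "Pow {0..<p} \<times> Pow {0..<p} \<times> Pow {0..<p}"])
    (auto simp: sum_free_triples_def)

text \<open>Solving for a different set each time, the condition says that x + y avoids C, that y +
  x avoids C, or that z - x avoids B. The first two give translations, the third
  reflections.\<close>

lemma sum_free_triples_slots:
  shows "(A, B, C) \<in> sum_free_triples p \<longleftrightarrow> A \<subseteq> {0..<p} \<and> (B, C) \<in> avoid {0..<p} (shift p) A"
    and "(A, B, C) \<in> sum_free_triples p \<longleftrightarrow> B \<subseteq> {0..<p} \<and> (A, C) \<in> avoid {0..<p} (shift p) B"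
    and "(A, B, C) \<in> sum_free_triples p \<longleftrightarrow> C \<subseteq> {0..<p} \<and> (A, B) \<in> avoid {0..<p} (reflect p) C"
proof -
  let ?U = "Pow {0..<p}"
  have eq: "(A, B, C) \<in> sum_free_triples p \<longleftrightarrow>
      A \<in> ?U \<and> B \<in> ?U \<and> C \<in> ?U \<and> (\<forall>x\<in>A. \<forall>y\<in>B. shift p x y \<notin> C)"
    by (simp add: sum_free_triples_def sum_free_triple_def shift_def) blast
  show "(A, B, C) \<in> sum_free_triples p \<longleftrightarrow> A \<subseteq> {0..<p} \<and> (B, C) \<in> avoid {0..<p} (shift p) A"
    unfolding eq by (auto simp: avoid_def)
  have "(\<forall>x\<in>A. \<forall>y\<in>B. shift p x y \<notin> C) \<longleftrightarrow> (\<forall>y\<in>B. \<forall>x\<in>A. shift p y x \<notin> C)"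
    by (metis shift_commute)
  then show "(A, B, C) \<in> sum_free_triples p \<longleftrightarrow> B \<subseteq> {0..<p} \<and> (A, C) \<in> avoid {0..<p} (shift p) B"
    unfolding eq by (auto simp: avoid_def)
  have "(\<forall>x\<in>A. \<forall>y\<in>B. shift p x y \<notin> C) \<longleftrightarrow> (\<forall>z\<in>C. \<forall>x\<in>A. reflect p z x \<notin> B)"
    if "A \<in> ?U" "B \<in> ?U" "C \<in> ?U"
  proof -
    have "shift p x y = z \<longleftrightarrow> reflect p z x = y" if "x \<in> A" "y \<in> B" "z \<in> C" for x y z
      using that \<open>A \<in> ?U\<close> \<open>B \<in> ?U\<close> \<open>C \<in> ?U\<close> by (subst reflect_eq_iff) auto
    then show ?thesis by metis
  qed
  then show "(A, B, C) \<in> sum_free_triples p \<longleftrightarrow> C \<subseteq> {0..<p} \<and> (A, B) \<in> avoid {0..<p} (reflect p) C"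
    unfolding eq by (auto simp: avoid_def)
qed

lemma card_sum_free_slot:
  fixes P :: "nat set \<Rightarrow> bool" and p :: nat
  defines "\<S> \<equiv> {S. S \<subseteq> {0..<p} \<and> P S}"
  shows "card {(A, B, C) \<in> sum_free_triples p. P A} = card (SIGMA S:\<S>. avoid {0..<p} (shift p) S)"
    and "card {(A, B, C) \<in> sum_free_triples p. P B} = card (SIGMA S:\<S>. avoid {0..<p} (shift p) S)"
    and "card {(A, B, C) \<in> sum_free_triples p. P C} = card (SIGMA S:\<S>. avoid {0..<p} (reflect p) S)"
proof -
  have "bij_betw id {(A, B, C) \<in> sum_free_triples p. P A} (SIGMA S:\<S>. avoid {0..<p} (shift p) S)"
    by (rule bij_betwI[where g = id]) (auto simp: \<S>_def sum_free_triples_slots(1))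
  then show "card {(A, B, C) \<in> sum_free_triples p. P A} = card (SIGMA S:\<S>. avoid {0..<p} (shift p) S)"
    by (rule bij_betw_same_card)
  have "bij_betw (\<lambda>(A, B, C). (B, A, C)) {(A, B, C) \<in> sum_free_triples p. P B} (SIGMA S:\<S>. avoid {0..<p} (shift p) S)"
    by (rule bij_betwI[where g = "\<lambda>(B, A, C). (A, B, C)"]) (auto simp: \<S>_def sum_free_triples_slots(2))
  then show "card {(A, B, C) \<in> sum_free_triples p. P B} = card (SIGMA S:\<S>. avoid {0..<p} (shift p) S)"
    by (rule bij_betw_same_card)
  have "bij_betw (\<lambda>(A, B, C). (C, A, B)) {(A, B, C) \<in> sum_free_triples p. P C} (SIGMA S:\<S>. avoid {0..<p} (reflect p) S)"
    by (rule bij_betwI[where g = "\<lambda>(C, A, B). (A, B, C)"]) (auto simp: \<S>_def sum_free_triples_slots(3))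
  then show "card {(A, B, C) \<in> sum_free_triples p. P C} = card (SIGMA S:\<S>. avoid {0..<p} (reflect p) S)"
    by (rule bij_betw_same_card)
qed

text \<open>Each two-set projection avoids the bijections indexed by the large third set, so the
  container count bounds all three projections and Loomis-Whitney combines them.\<close>

lemma card_sum_free_all_large_le:
  assumes "prime p" "10000 * 1010000 \<le> p"
  shows "real (card {(A, B, C) \<in> sum_free_triples p. 1010000 \<le> card A \<and> 1010000 \<le> card B \<and> 1010000 \<le> card C})
    \<le> (29/10) ^ p"
proof -
  define R where "R = {(A, B, C) \<in> sum_free_triples p. 1010000 \<le> card A \<and> 1010000 \<le> card B \<and> 1010000 \<le> card C}"
  define L where "L F = (\<Union>S\<in>{S. S \<subseteq> {0..<p} \<and> 1010000 \<le> card S}. avoid {0..<p} F S)" for F :: "nat \<Rightarrow> nat \<Rightarrow> nat"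
  define N :: real where "N = ((1001/1000) ^ 4 * (202/100)) ^ p"
  have N0: "0 \<le> N" by (simp add: N_def)
  have L: "real (card (L F)) \<le> N" if "latin_family {0..<p} F" for F
  proof -
    have "N = (1001/1000) ^ (4 * p) * (202/100) ^ p"
      by (simp only: N_def power_mult power_mult_distrib)
    then show ?thesis using card_avoid_many_le[OF that] assms(2) by (simp add: L_def)
  qed
  have fL: "finite (L F)" for F by (auto simp: L_def finite_avoid)
  have fR: "finite R"
    by (rule finite_subset[OF _ finite_sum_free_triples[of p]]) (auto simp: R_def)
  have P1: "(A, B) \<in> L (reflect p)" if "(A, B, C) \<in> R" for A B C
    using that unfolding R_def L_def by (auto simp: sum_free_triples_slots(3))
  have P2: "(A, C) \<in> L (shift p)" if "(A, B, C) \<in> R" for A B C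
    using that unfolding R_def L_def by (auto simp: sum_free_triples_slots(2))
  have P3: "(B, C) \<in> L (shift p)" if "(A, B, C) \<in> R" for A B C
    using that unfolding R_def L_def by (auto simp: sum_free_triples_slots(1))
  have "(card R)\<^sup>2 \<le> card (L (reflect p)) * card (L (shift p)) * card (L (shift p))"
    by (rule Loomis_Whitney[OF fR fL P1 fL P2 fL P3])
  then have "(real (card R))\<^sup>2 \<le> real (card (L (reflect p))) * real (card (L (shift p))) * real (card (L (shift p)))"
    by (simp only: of_nat_power[symmetric] of_nat_mult[symmetric] of_nat_le_iff)
  also have "\<dots> \<le> N * N * N"
    using L[OF latin_family_reflect[OF assms(1)]] L[OF latin_family_shift[OF assms(1)]] N0
    by (intro mult_mono) auto
  also have "\<dots> = (((1001/1000) ^ 4 * (202/100)) ^ 3) ^ p"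
    by (simp add: N_def power3_eq_cube flip: power_mult_distrib)
  \<comment> \<open>Numerically (1.001^4 * 2.02)^3 is about 8.342, below 2.9^2 = 8.41.\<close>
  also have "\<dots> \<le> ((29/10) ^ 2) ^ p"
    by (intro power_mono) (simp_all add: power_divide)
  also have "\<dots> = ((29/10) ^ p)\<^sup>2" by (simp only: power_mult[symmetric] mult.commute)
  finally have "real (card R) \<le> (29/10) ^ p" by (rule power2_le_imp_le) simp
  then show ?thesis by (simp add: R_def)
qed

section \<open>Overlaps and the final estimate\<close>

lemma card_Un3_ge:
  assumes "finite X" "finite Y" "finite Z"
  shows "card X + card Y + card Z \<le> card (X \<union> Y \<union> Z) + card (X \<inter> Y) + card (X \<inter> Z) + card (Y \<inter> Z)"
proof -
  have "card X + card Y = card (X \<union> Y) + card (X \<inter> Y)" using assms by (intro card_Un_Int)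
  moreover have "card (X \<union> Y) + card Z = card (X \<union> Y \<union> Z) + card ((X \<union> Y) \<inter> Z)"
    using assms by (intro card_Un_Int) auto
  moreover have "card ((X \<union> Y) \<inter> Z) \<le> card (X \<inter> Z) + card (Y \<inter> Z)"
    unfolding Int_Un_distrib2 by (rule card_Un_le)
  ultimately show ?thesis by linarith
qed

lemma card_subsets_le_one:
  assumes "finite U"
  shows "card {S. S \<subseteq> U \<and> card S \<le> 1} \<le> card U + 1"
proof -
  have "card {S. S \<subseteq> U \<and> card S \<le> 1} \<le> card ((\<lambda>i. {i}) ` U) + 1"
    using assms unfolding subsets_card_le_one[OF assms] by (simp add: card_insert_if)
  also have "\<dots> \<le> card U + 1" using assms by (simp add: card_image_le)
  finally show ?thesis .
qed

text \<open>Absorbs the overlaps, where two sets have at most one element and the third is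
  arbitrary. Bernoulli gives p + 1 <= 5 * 1.2^p, and 1.2^2 * 2 = 2.88 < 2.9.\<close>

lemma square_mult_two_power_le: "(real p + 1)\<^sup>2 * 2 ^ p \<le> 25 * (29/10) ^ p"
proof -
  have "1 + real p * (1/5) \<le> (1 + 1/5) ^ p" by (rule Bernoulli_inequality) simp
  then have "real p + 1 \<le> 5 * (6/5) ^ p" by simp
  then have "(real p + 1)\<^sup>2 \<le> (5 * (6/5) ^ p)\<^sup>2" by (rule power_mono) simp
  also have "\<dots> = 25 * (36/25) ^ p"
    by (simp add: power2_eq_square flip: power_mult_distrib)
  finally have "(real p + 1)\<^sup>2 * 2 ^ p \<le> 25 * (36/25) ^ p * 2 ^ p"
    by (rule mult_right_mono) simp
  also have "\<dots> = 25 * (72/25) ^ p" by (simp flip: power_mult_distrib)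
  also have "\<dots> \<le> 25 * (29/10) ^ p" by (intro mult_left_mono power_mono) auto
  finally show ?thesis .
qed

theorem theorem14:
  shows "\<exists>(c::real) (K::real) (p0::nat). c > 0 \<and> K > 0 \<and>
           (\<forall>p. prime p \<and> p \<ge> p0 \<longrightarrow>
              \<bar>real (T p) - 3 * 4 ^ p - 3 * real p * 3 ^ p\<bar> \<le> K * (3 - c) ^ p)"
proof (intro exI conjI allI impI)
  \<comment> \<open>With c = 1/10 the error base is 2.9. K = 100 covers the losses 75 below and 10
    above, and the threshold on p makes sets of size 1010000 small in the sense of
    \<open>card_small_subsets_le\<close>.\<close>
  show "(1/10::real) > 0" "(100::real) > 0" by simp_all
  fix p :: nat
  assume "prime p \<and> p \<ge> 10000 * 1010000"
  then have p: "prime p" "10000 * 1010000 \<le> p" by auto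
  define G where "G = sum_free_triples p"
  define X where "X P Q R = {(A, B, C) \<in> G. P A \<and> Q B \<and> R C}" for P Q R :: "nat set \<Rightarrow> bool"
  \<comment> \<open>trivially true, small, medium and large, respectively\<close>
  define t :: "nat set \<Rightarrow> bool" where "t A \<longleftrightarrow> True" for A
  define s :: "nat set \<Rightarrow> bool" where "s A \<longleftrightarrow> card A \<le> 1" for A
  define m :: "nat set \<Rightarrow> bool" where "m A \<longleftrightarrow> 2 \<le> card A \<and> card A \<le> 1010000" for A
  define l :: "nat set \<Rightarrow> bool" where "l A \<longleftrightarrow> 1010000 \<le> card A" for A
  have X1: "X P t t = {(A, B, C) \<in> sum_free_triples p. P A}"
    and X2: "X t P t = {(A, B, C) \<in> sum_free_triples p. P B}"
    and X3: "X t t P = {(A, B, C) \<in> sum_free_triples p. P C}" for P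
    by (auto simp: X_def G_def t_def)
  have fG: "finite G" by (simp add: G_def finite_sum_free_triples)
  have fX: "finite (X P Q R)" for P Q R
    by (rule finite_subset[OF _ fG]) (auto simp: X_def)
  have s_card: "card (X s t t) = 4 ^ p + p * 3 ^ p" "card (X t s t) = 4 ^ p + p * 3 ^ p"
    "card (X t t s) = 4 ^ p + p * 3 ^ p"
    using card_avoid_le_one[OF latin_family_shift[OF p(1)]] card_avoid_le_one[OF latin_family_reflect[OF p(1)]]
    unfolding X1 X2 X3 s_def card_sum_free_slot by simp_all
  define \<epsilon> :: real where "\<epsilon> = (29/10) ^ p"
  \<comment> \<open>Here 1.001^2 * 2.85 is about 2.856, below 2.9.\<close>
  have "(1001/1000) ^ (2 * p) * (3 * (57/20) ^ p) = 3 * ((1001/1000) ^ 2 * (57/20 :: real)) ^ p"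
    unfolding power_mult power_mult_distrib by simp
  also have "\<dots> \<le> 3 * \<epsilon>"
    unfolding \<epsilon>_def by (intro mult_left_mono power_mono) (simp_all add: power_divide)
  finally have "(1001/1000) ^ (2 * p) * (3 * (57/20) ^ p) \<le> 3 * \<epsilon>" .
  then have m_card: "real (card (X m t t)) \<le> 3 * \<epsilon>" "real (card (X t m t)) \<le> 3 * \<epsilon>"
    "real (card (X t t m)) \<le> 3 * \<epsilon>"
    using card_avoid_medium_le[OF latin_family_shift[OF p(1)], of 1010000]
      card_avoid_medium_le[OF latin_family_reflect[OF p(1)], of 1010000] p(2)
    unfolding X1 X2 X3 m_def card_sum_free_slot by simp_all
  have l_card: "real (card (X l l l)) \<le> \<epsilon>"
    using card_sum_free_all_large_le[OF p] by (simp add: X_def G_def l_def \<epsilon>_def)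
  let ?S = "{S. S \<subseteq> {0..<p} \<and> card S \<le> 1}" and ?U = "Pow {0..<p}"
  have fS: "finite ?S" by auto
  have S_card: "card ?S * card ?S * card ?U \<le> (p + 1)\<^sup>2 * 2 ^ p"
  proof -
    have "card ?S \<le> p + 1" using card_subsets_le_one[of "{0..<p}"] by simp
    moreover have "card ?U = 2 ^ p" by (simp add: card_Pow)
    ultimately show ?thesis unfolding power2_eq_square by (intro mult_le_mono) simp_all
  qed
  have pair: "real (card Y) \<le> 25 * \<epsilon>" if "card Y \<le> card ?S * card ?S * card ?U"
    for Y :: "(nat set \<times> nat set \<times> nat set) set"
  proof -
    have "card Y \<le> (p + 1)\<^sup>2 * 2 ^ p" using that S_card by linarith
    then have "real (card Y) \<le> real ((p + 1)\<^sup>2 * 2 ^ p)" by (simp only: of_nat_le_iff)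
    also have "\<dots> = (real p + 1)\<^sup>2 * 2 ^ p" by (simp add: add.commute)
    also have "\<dots> \<le> 25 * \<epsilon>" unfolding \<epsilon>_def by (rule square_mult_two_power_le)
    finally show ?thesis .
  qed
  have sub: "A \<subseteq> {0..<p}" "B \<subseteq> {0..<p}" "C \<subseteq> {0..<p}" if "(A, B, C) \<in> G" for A B C
    using that by (auto simp: G_def sum_free_triples_def)
  have sub2: "X s t t \<inter> X t s t \<subseteq> ?S \<times> ?S \<times> ?U" "X s t t \<inter> X t t s \<subseteq> ?S \<times> ?U \<times> ?S"
    "X t s t \<inter> X t t s \<subseteq> ?U \<times> ?S \<times> ?S"
    using sub by (fastforce simp: X_def s_def)+
  have pairs: "real (card (X s t t \<inter> X t s t)) \<le> 25 * \<epsilon>" "real (card (X s t t \<inter> X t t s)) \<le> 25 * \<epsilon>"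
    "real (card (X t s t \<inter> X t t s)) \<le> 25 * \<epsilon>"
    by (rule pair[OF order_trans[OF card_mono[OF _ sub2(1)]]]
        pair[OF order_trans[OF card_mono[OF _ sub2(2)]]]
        pair[OF order_trans[OF card_mono[OF _ sub2(3)]]], use fS in simp,
        simp only: card_cartesian_product ac_simps)+
  \<comment> \<open>\<open>Y\<close> carries the main term: the three slot counts overestimate its
    size by at most the three overlaps, each at most \<open>25 * \<epsilon>\<close>.\<close>
  define Y where "Y = X s t t \<union> X t s t \<union> X t t s"
  have "card (X s t t) + card (X t s t) + card (X t t s)
      \<le> card Y + card (X s t t \<inter> X t s t) + card (X s t t \<inter> X t t s) + card (X t s t \<inter> X t t s)"
    unfolding Y_def by (intro card_Un3_ge fX)
  then have "real (card (X s t t) + card (X t s t) + card (X t t s))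
      \<le> real (card Y + card (X s t t \<inter> X t s t) + card (X s t t \<inter> X t t s) + card (X t s t \<inter> X t t s))"
    by (simp only: of_nat_le_iff)
  then have lower: "3 * 4 ^ p + 3 * real p * 3 ^ p \<le> real (card Y) + 75 * \<epsilon>"
    using pairs unfolding s_card by simp
  have "card Y \<le> card G" using fG by (intro card_mono) (auto simp: Y_def X_def)
  \<comment> \<open>If no set is small or medium, all three are large. Medium and large share the
    size 1010000, which is harmless in a union bound. The error is three times
    \<open>3 * \<epsilon>\<close> plus \<open>\<epsilon>\<close>.\<close>
  have "G \<subseteq> Y \<union> (X m t t \<union> X t m t \<union> X t t m \<union> X l l l)"
    by (auto simp: Y_def X_def s_def t_def m_def l_def)
  then have "card G \<le> card (Y \<union> (X m t t \<union> X t m t \<union> X t t m \<union> X l l l))"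
    by (intro card_mono) (auto simp: Y_def fX)
  also have "\<dots> \<le> card (X s t t) + card (X t s t) + card (X t t s)
      + (card (X m t t) + card (X t m t) + card (X t t m) + card (X l l l))"
    unfolding Y_def by (intro order_trans[OF card_Un_le] add_mono order_refl)
  finally have "real (card G) \<le> real (card (X s t t) + card (X t s t) + card (X t t s)
      + (card (X m t t) + card (X t m t) + card (X t t m) + card (X l l l)))"
    by (simp only: of_nat_le_iff)
  then have upper: "real (card G) \<le> 3 * 4 ^ p + 3 * real p * 3 ^ p + 10 * \<epsilon>"
    using m_card l_card unfolding s_card by simp
  have "T p = card G" by (simp add: T_def G_def sum_free_triples_def)
  moreover have "0 \<le> \<epsilon>" by (simp add: \<epsilon>_def)
  ultimately have "\<bar>real (T p) - 3 * 4 ^ p - 3 * real p * 3 ^ p\<bar> \<le> 100 * \<epsilon>"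
    using lower upper \<open>card Y \<le> card G\<close> unfolding abs_le_iff by linarith
  then show "\<bar>real (T p) - 3 * 4 ^ p - 3 * real p * 3 ^ p\<bar> \<le> 100 * (3 - 1/10) ^ p"
    by (simp add: \<epsilon>_def)
qed

end
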